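(* Let $\Phi^0\in\mathcal{M}_h$ and let $\Phi^{n}\in\mathcal{M}_h$, $n=1,\dots,N$, be generated by the stabilized fully-discrete scheme $$\Big(\frac1\tau+\frac{\kappa_h}{\epsilon}\Big)(\Phi^{n+1}-\Phi^n)=\epsilon\Delta_h\Phi^{n+1}-\frac1\epsilon W'(\Phi^n)-\gamma\big[(-\Delta_h)^{-1}(f(\Phi^n)-\omega)\big]\odot f'(\Phi^n)-M\langle f(\Phi^n)-\omega,1\rangle_h\,f'(\Phi^n).$$ Suppose $$\frac1\tau+\frac{\kappa_h}{\epsilon}\ \ge\ \frac{L_{W''}}{\epsilon}+\tilde\omega L_{f''}\Big(\gamma\|(-\Delta_h)^{-1}\|+M|\mathbb{T}^2|\Big).$$ Then the scheme is maximum principle preserving: if $0\le\Phi^0\le1$, then $0\le\Phi^n\le1$ for all $n\in\{1,\dots,N\}$.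
   Context: $\mathbb{T}^2=\prod_{i=1}^2[-X_i,X_i]$ is a periodic box; $N_1,N_2$ are positive even integers, $h_i=2X_i/N_i$, $\mathbb{T}^2_h=\mathbb{T}^2\cap(h_1\mathbb{Z}\times h_2\mathbb{Z})$, $S_h=\{(k_1,k_2)\in\mathbb{Z}^2:1\le k_i\le N_i\}$, and $\mathcal{M}_h$ is the space of real periodic grid functions ($u_{k_1+m_1N_1,k_2+m_2N_2}=u_{k_1,k_2}$ for all $m_1,m_2\in\mathbb{Z}$). $\langle u,v\rangle_h=h_1h_2\sum_{(i,j)\in S_h}u_{ij}v_{ij}$, $\|u\|_{h,L^\infty}=\max_{S_h}|u_{ij}|$. $(\Delta_hu)_{ij}=h_1^{-2}(u_{i-1,j}-2u_{ij}+u_{i+1,j})+h_2^{-2}(u_{i,j-1}-2u_{ij}+u_{i,j+1})$ with periodic indices. $\Delta_h$ is invertible on mean-zero grid functions; for $g\in\mathcal{M}_h$, $(-\Delta_h)^{-1}g$ denotes the mean-zero $u$ with $-\Delta_hu=g-\frac{1}{|\mathbb{T}^2|}\langle g,1\rangle_h$. $\|(-\Delta_h)^{-1}\|$ is the optimal $C$ in $\|(-\Delta_h)^{-1}g\|_{h,L^\infty}\le C\|g\|_{h,L^\infty}$, $g\in\mathcal{M}_h$. $\odot$ is pointwise multiplication; $W',f,f'$ act pointwise; inequalities between grid functions and constants are pointwise. The parameters are $\epsilon>0$, $\gamma>0$, $M>0$, $\kappa_h>0$, $\omega\in(0,1)$, $\tilde\omega=\max\{\omega,1-\omega\}$; $T>0$,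 $N>0$ is an integer, $\tau=T/N$. $W(s)=18(s^2-s)^2$, $f(s)=3s^2-2s^3$, $L_{W''}=\|W''\|_{L^\infty[0,1]}$, $L_{f''}=\|f''\|_{L^\infty[0,1]}$. *)

theory Defs
  imports "HOL-Probability.Essential_Supremum"
begin

text \<open>The box is \<open>[-X1, X1] \<times> [-X2, X2]\<close>, with \<open>N1\<close> and \<open>N2\<close> grid intervals per direction.
  A grid function is a doubly indexed family \<open>u :: int \<Rightarrow> int \<Rightarrow> real\<close>, where \<open>u i j\<close> is the value at
  the grid point \<open>(i * h1, j * h2)\<close>, subject to the periodicity expressed in \<open>grid_fun\<close>.\<close>

definition box_area :: "real \<Rightarrow> real \<Rightarrow> real" where
  "box_area X1 X2 = measure lborel ({-X1..X1} \<times> {-X2..X2})"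

definition mesh_size :: "real \<Rightarrow> nat \<Rightarrow> real" where
  "mesh_size X N = 2 * X / real N"

definition grid_index :: "nat \<Rightarrow> nat \<Rightarrow> (int \<times> int) set" where
  "grid_index N1 N2 = {1..int N1} \<times> {1..int N2}"

definition grid_fun :: "nat \<Rightarrow> nat \<Rightarrow> (int \<Rightarrow> int \<Rightarrow> real) set" where
  "grid_fun N1 N2 =
     {u. \<forall>k1 k2 m1 m2. u (k1 + m1 * int N1) (k2 + m2 * int N2) = u k1 k2}"

definition grid_inner ::
  "real \<Rightarrow> real \<Rightarrow> nat \<Rightarrow> nat \<Rightarrow> (int \<Rightarrow> int \<Rightarrow> real) \<Rightarrow> (int \<Rightarrow> int \<Rightarrow> real) \<Rightarrow> real" where
  "grid_inner X1 X2 N1 N2 u v =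
     mesh_size X1 N1 * mesh_size X2 N2 * (\<Sum>(i, j)\<in>grid_index N1 N2. u i j * v i j)"

definition grid_Linf :: "nat \<Rightarrow> nat \<Rightarrow> (int \<Rightarrow> int \<Rightarrow> real) \<Rightarrow> real" where
  "grid_Linf N1 N2 u = Max ((\<lambda>(i, j). \<bar>u i j\<bar>) ` grid_index N1 N2)"

definition grid_lap ::
  "real \<Rightarrow> real \<Rightarrow> nat \<Rightarrow> nat \<Rightarrow> (int \<Rightarrow> int \<Rightarrow> real) \<Rightarrow> int \<Rightarrow> int \<Rightarrow> real" where
  "grid_lap X1 X2 N1 N2 u i j =
     (u (i - 1) j - 2 * u i j + u (i + 1) j) / (mesh_size X1 N1)\<^sup>2 +
     (u i (j - 1) - 2 * u i j + u i (j + 1)) / (mesh_size X2 N2)\<^sup>2"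

text \<open>\<open>(-\<Delta>\<^sub>h)\<^sup>-\<^sup>1 g\<close>: the unique mean-zero periodic solution; the mean of \<open>g\<close> is subtracted so that the
  operator is defined on all grid functions, not only on the mean-zero ones.\<close>

definition neg_lap_inv ::
  "real \<Rightarrow> real \<Rightarrow> nat \<Rightarrow> nat \<Rightarrow> (int \<Rightarrow> int \<Rightarrow> real) \<Rightarrow> int \<Rightarrow> int \<Rightarrow> real" where
  "neg_lap_inv X1 X2 N1 N2 g =
     (THE u. u \<in> grid_fun N1 N2 \<and> grid_inner X1 X2 N1 N2 u (\<lambda>_ _. 1) = 0 \<and>
        (\<forall>i j. - grid_lap X1 X2 N1 N2 u i j =
           g i j - 1 / box_area X1 X2 * grid_inner X1 X2 N1 N2 g (\<lambda>_ _. 1)))"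

definition neg_lap_inv_norm :: "real \<Rightarrow> real \<Rightarrow> nat \<Rightarrow> nat \<Rightarrow> real" where
  "neg_lap_inv_norm X1 X2 N1 N2 =
     Inf {C. \<forall>g\<in>grid_fun N1 N2.
       grid_Linf N1 N2 (neg_lap_inv X1 X2 N1 N2 g) \<le> C * grid_Linf N1 N2 g}"

definition Wpot :: "real \<Rightarrow> real" where
  "Wpot s = 18 * (s\<^sup>2 - s)\<^sup>2"

definition fint :: "real \<Rightarrow> real" where
  "fint s = 3 * s\<^sup>2 - 2 * s ^ 3"

text \<open>The essential supremum takes values in the extended reals, hence the two coercions.
  It is only used for functions that are bounded on \<open>[0, 1]\<close>.\<close>

definition Linf_unit :: "(real \<Rightarrow> real) \<Rightarrow> real" where
  "Linf_unit g = real_of_ereal (esssup (lebesgue_on {0..1}) (\<lambda>s. ereal \<bar>g s\<bar>))"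

end

theory Submission
  imports Defs "Jordan_Normal_Form.Determinant"
begin

text \<open>Write \<open>S = 1/\<tau> + \<kappa>/\<epsilon>\<close>. One step of the scheme is
  \<open>S \<Phi>\<^sub>n\<^sub>+\<^sub>1 - \<epsilon> \<Delta>\<^sub>h \<Phi>\<^sub>n\<^sub>+\<^sub>1 = S \<Phi>\<^sub>n - W'(\<Phi>\<^sub>n)/\<epsilon> - A f'(\<Phi>\<^sub>n)\<close>, where the nonlocal coefficient
  \<open>A = \<gamma> (-\<Delta>\<^sub>h)\<^sup>-\<^sup>1 (f(\<Phi>\<^sub>n) - \<omega>) + M \<langle>f(\<Phi>\<^sub>n) - \<omega>, 1\<rangle>\<close> is, at each grid point, a number. If
  \<open>0 \<le> \<Phi>\<^sub>n \<le> 1\<close>, then \<open>\<bar>f(\<Phi>\<^sub>n) - \<omega>\<bar> \<le> max \<omega> (1 - \<omega>)\<close>, so \<open>\<bar>A\<bar>\<close> is controlled by the operator norm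
  of \<open>(-\<Delta>\<^sub>h)\<^sup>-\<^sup>1\<close> and the area of the box. The stabilization condition then says that, for such a
  fixed \<open>A\<close>, the function \<open>s \<mapsto> S s - W'(s)/\<epsilon> - A f'(s)\<close> has nonnegative derivative on \<open>[0, 1]\<close>. As \<open>W'\<close>
  and \<open>f'\<close> vanish at \<open>0\<close> and \<open>1\<close>, its values lie in \<open>[0, S]\<close> (\<open>stabilized_reaction_bounds\<close>). At a
  maximum point of \<open>\<Phi>\<^sub>n\<^sub>+\<^sub>1\<close> the discrete Laplacian is nonpositive, and at a minimum point it is
  nonnegative, so \<open>0 \<le> \<Phi>\<^sub>n\<^sub>+\<^sub>1 \<le> 1\<close> (\<open>elliptic_grid_max_principle\<close>, \<open>elliptic_grid_min_principle\<close>).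

  Two points need an argument because of how the constants are defined. The operator norm is an infimum
  over admissible constants, and \<open>(-\<Delta>\<^sub>h)\<^sup>-\<^sup>1\<close> is a definite description; both are meaningful only once the
  discrete Poisson problem is known to be uniquely solvable with a bounded solution operator. This is
  finite-dimensional linear algebra: \<open>-\<Delta>\<^sub>h\<close> plus the sum over one period is injective by the maximum
  principle, hence invertible (\<open>discrete_Poisson_solvable\<close>, \<open>neg_lap_inv_norm_bound\<close>). The constants
  \<open>L\<^bsub>W''\<^esub>\<close> and \<open>L\<^bsub>f''\<^esub>\<close> are essential suprema, which for continuous functions bound every value
  (\<open>abs_le_Linf_unit\<close>).\<close>

section \<open>Periodic grid functions and the discrete Laplacian\<close>

text \<open>The representative of an index in the fundamental period \<open>{1..N}\<close>.\<close>

definition wrap :: "nat \<Rightarrow> int \<Rightarrow> int" where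
  "wrap N i = (i - 1) mod int N + 1"

lemma wrap_mem: "N > 0 \<Longrightarrow> wrap N i \<in> {1..int N}"
  using pos_mod_bound[of "int N" "i - 1"] pos_mod_sign[of "int N" "i - 1"]
  unfolding wrap_def atLeastAtMost_iff by linarith

lemma wrap_mem_grid_index:
  "N1 > 0 \<Longrightarrow> N2 > 0 \<Longrightarrow> (wrap N1 i, wrap N2 j) \<in> grid_index N1 N2"
  using wrap_mem[of N1 i] wrap_mem[of N2 j] by (simp add: grid_index_def)

lemma wrap_id: "i \<in> {1..int N} \<Longrightarrow> wrap N i = i"
  by (simp add: wrap_def)

lemma wrap_add_period: "wrap N (i + m * int N) = wrap N i"
proof -
  have "i + m * int N - 1 = (i - 1) + m * int N"
    by simp
  then show ?thesis
    unfolding wrap_def by (simp only: mod_mult_self1)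
qed

lemma grid_fun_wrap:
  assumes "u \<in> grid_fun N1 N2"
  shows "u (wrap N1 i) (wrap N2 j) = u i j"
proof -
  have "wrap N i = i + (- ((i - 1) div int N)) * int N" for N i
    using div_mult_mod_eq[of "i - 1" "int N"] unfolding wrap_def by (simp add: algebra_simps)
  then show ?thesis
    using assms by (simp only: grid_fun_def mem_Collect_eq)
qed

lemma grid_fun_ext: "(\<lambda>i j. x (wrap N1 i, wrap N2 j)) \<in> grid_fun N1 N2"
  by (simp add: grid_fun_def wrap_add_period)

lemma grid_fun_comp: "u \<in> grid_fun N1 N2 \<Longrightarrow> (\<lambda>i j. F (u i j)) \<in> grid_fun N1 N2"
  by (simp add: grid_fun_def)

lemma grid_fun_comp2:
  "u \<in> grid_fun N1 N2 \<Longrightarrow> v \<in> grid_fun N1 N2 \<Longrightarrow> (\<lambda>i j. F (u i j) (v i j)) \<in> grid_fun N1 N2"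
  by (simp add: grid_fun_def)

lemma grid_fun_shift:
  assumes "u \<in> grid_fun N1 N2"
  shows "(\<lambda>i j. u (i + a) (j + b)) \<in> grid_fun N1 N2"
proof -
  have "u (k1 + m1 * int N1 + a) (k2 + m2 * int N2 + b) = u (k1 + a) (k2 + b)" for k1 k2 m1 m2
  proof -
    have "k1 + m1 * int N1 + a = k1 + a + m1 * int N1" "k2 + m2 * int N2 + b = k2 + b + m2 * int N2"
      by simp_all
    then show ?thesis
      using assms by (simp only: grid_fun_def mem_Collect_eq)
  qed
  then show ?thesis
    by (simp add: grid_fun_def)
qed

lemma finite_grid_index: "finite (grid_index N1 N2)"
  by (simp add: grid_index_def)

lemma card_grid_index: "card (grid_index N1 N2) = N1 * N2"
  by (simp add: grid_index_def card_cartesian_product)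

lemma grid_fun_attains_max:
  assumes "N1 > 0" "N2 > 0" "u \<in> grid_fun N1 N2"
  obtains i j where "\<And>k l. u k l \<le> u i j"
proof -
  let ?I = "grid_index N1 N2" and ?f = "\<lambda>p. u (fst p) (snd p)"
  have ne: "?f ` ?I \<noteq> {}"
    using wrap_mem_grid_index[OF assms(1,2)] by blast
  obtain p where p: "p \<in> ?I" "Max (?f ` ?I) = ?f p"
    using Max_in[OF _ ne] finite_grid_index[of N1 N2] by blast
  have "u k l \<le> u (fst p) (snd p)" for k l
  proof -
    have "?f (wrap N1 k, wrap N2 l) \<le> Max (?f ` ?I)"
      by (intro Max_ge imageI finite_imageI finite_grid_index wrap_mem_grid_index assms)
    then show ?thesis
      using p grid_fun_wrap[OF assms(3)] by simp
  qed
  then show thesis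
    using that by blast
qed

lemma grid_Linf_ge:
  assumes "N1 > 0" "N2 > 0" "u \<in> grid_fun N1 N2"
  shows "\<bar>u i j\<bar> \<le> grid_Linf N1 N2 u"
proof -
  have "(\<lambda>(i, j). \<bar>u i j\<bar>) (wrap N1 i, wrap N2 j) \<le> grid_Linf N1 N2 u"
    unfolding grid_Linf_def
    by (intro Max_ge imageI finite_imageI finite_grid_index wrap_mem_grid_index assms)
  then show ?thesis
    using grid_fun_wrap[OF assms(3)] by simp
qed

lemma grid_Linf_le:
  assumes "N1 > 0" "N2 > 0" "\<And>i j. \<bar>u i j\<bar> \<le> C"
  shows "grid_Linf N1 N2 u \<le> C"
proof -
  have "grid_index N1 N2 \<noteq> {}"
    using wrap_mem_grid_index[OF assms(1,2)] by blast
  then show ?thesis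
    unfolding grid_Linf_def using assms(3) finite_grid_index[of N1 N2]
    by (subst Max_le_iff) auto
qed

lemma grid_lap_nonpos_at_max:
  assumes "\<And>k l. u k l \<le> u i j"
  shows "grid_lap X1 X2 N1 N2 u i j \<le> 0"
proof -
  have "u (i - 1) j - 2 * u i j + u (i + 1) j \<le> 0" "u i (j - 1) - 2 * u i j + u i (j + 1) \<le> 0"
    using assms[of "i - 1" j] assms[of "i + 1" j] assms[of i "j - 1"] assms[of i "j + 1"] by simp_all
  then show ?thesis
    unfolding grid_lap_def
    by (intro add_nonpos_nonpos[OF divide_nonpos_nonneg divide_nonpos_nonneg] zero_le_power2)
qed

lemma grid_lap_uminus:
  "grid_lap X1 X2 N1 N2 (\<lambda>i j. - u i j) i j = - grid_lap X1 X2 N1 N2 u i j"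
  unfolding grid_lap_def minus_add_distrib minus_divide_left by (simp add: algebra_simps)

lemma grid_lap_diff:
  "grid_lap X1 X2 N1 N2 (\<lambda>i j. u i j - v i j) i j =
    grid_lap X1 X2 N1 N2 u i j - grid_lap X1 X2 N1 N2 v i j"
  unfolding grid_lap_def by (simp add: diff_divide_distrib add_divide_distrib algebra_simps)

lemma grid_fun_lap:
  assumes "u \<in> grid_fun N1 N2"
  shows "grid_lap X1 X2 N1 N2 u \<in> grid_fun N1 N2"
proof -
  note sh = grid_fun_shift[OF assms]
  have "grid_lap X1 X2 N1 N2 u = (\<lambda>i j.
     (u (i + (- 1)) (j + 0) - 2 * u (i + 0) (j + 0) + u (i + 1) (j + 0)) / (mesh_size X1 N1)\<^sup>2 +
     (u (i + 0) (j + (- 1)) - 2 * u (i + 0) (j + 0) + u (i + 0) (j + 1)) / (mesh_size X2 N2)\<^sup>2)"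
    by (simp add: grid_lap_def fun_eq_iff)
  then show ?thesis
    using sh[of "-1" 0] sh[of 0 0] sh[of 1 0] sh[of 0 "-1"] sh[of 0 1]
    by (simp add: grid_fun_def)
qed

lemma sum_periodic_shift:
  fixes v :: "int \<Rightarrow> real"
  assumes "\<And>i. v (i + int N) = v i"
  shows "(\<Sum>i=1..int N. v (i + 1)) = (\<Sum>i=1..int N. v i)"
proof -
  have "(\<Sum>i=1..int n. v (i + 1)) = (\<Sum>i=1..int n. v i) + v (int n + 1) - v 1" for n
  proof (induction n)
    case (Suc n)
    have "{1..int (Suc n)} = insert (int n + 1) {1..int n}"
      by auto
    then show ?case
      using Suc by (simp add: algebra_simps)
  qed simp
  then show ?thesis
    using assms[of 1] by (simp add: add.commute)
qed

lemma sum_periodic_second_difference: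
  fixes v :: "int \<Rightarrow> real"
  assumes "\<And>i. v (i + int N) = v i"
  shows "(\<Sum>i=1..int N. v (i - 1) - 2 * v i + v (i + 1)) = 0"
proof -
  have "v (i + int N - 1) = v (i - 1)" for i
    using assms[of "i - 1"] by (simp add: algebra_simps)
  then have "(\<Sum>i=1..int N. v (i + 1 - 1)) = (\<Sum>i=1..int N. v (i - 1))"
    by (intro sum_periodic_shift) auto
  then show ?thesis
    using sum_periodic_shift[of v N, OF assms]
    by (simp add: sum.distrib sum_subtractf flip: sum_distrib_left)
qed

text \<open>Summation over one period removes second differences; this is what makes a zero mean necessary on
  the right-hand side of the Poisson problem.\<close>

lemma sum_grid_lap:
  assumes "u \<in> grid_fun N1 N2"
  shows "(\<Sum>(i, j)\<in>grid_index N1 N2. grid_lap X1 X2 N1 N2 u i j) = 0"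
proof -
  have u: "u (i + m1 * int N1) (j + m2 * int N2) = u i j" for i j m1 m2
    using assms by (simp add: grid_fun_def)
  have p1: "u (i + int N1) j = u i j" for i j
    using u[of i 1 j 0] by simp
  have p2: "u i (j + int N2) = u i j" for i j
    using u[of i 0 j 1] by simp
  have "(\<Sum>(i, j)\<in>grid_index N1 N2. grid_lap X1 X2 N1 N2 u i j) =
     (\<Sum>i=1..int N1. \<Sum>j=1..int N2. grid_lap X1 X2 N1 N2 u i j)"
    unfolding grid_index_def by (rule sum.cartesian_product[symmetric])
  also have "\<dots> =
      (\<Sum>j=1..int N2. (\<Sum>i=1..int N1. u (i - 1) j - 2 * u i j + u (i + 1) j) / (mesh_size X1 N1)\<^sup>2) +
      (\<Sum>i=1..int N1. (\<Sum>j=1..int N2. u i (j - 1) - 2 * u i j + u i (j + 1)) / (mesh_size X2 N2)\<^sup>2)"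
    unfolding grid_lap_def sum.distrib[of "\<lambda>j. _ j / _"] sum.distrib[of "\<lambda>i. \<Sum>j=_.._. _ i j / _"]
      sum_divide_distrib
    by (intro arg_cong2[where f = "(+)"] sum.swap refl)
  also have "\<dots> = 0"
    using sum_periodic_second_difference[of "\<lambda>i. u i _" N1, OF p1]
      sum_periodic_second_difference[of "\<lambda>j. u _ j" N2, OF p2]
    by simp
  finally show ?thesis .
qed

text \<open>At a maximum point all four neighbours of a discrete harmonic function share the maximal value,
  and the grid is connected through neighbours.\<close>

lemma grid_harmonic_const:
  assumes h: "mesh_size X1 N1 \<noteq> 0" "mesh_size X2 N2 \<noteq> 0"
    and N: "N1 > 0" "N2 > 0" and u: "u \<in> grid_fun N1 N2"
    and harm: "\<And>i j. grid_lap X1 X2 N1 N2 u i j = 0"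
  shows "\<exists>c. \<forall>i j. u i j = c"
proof -
  obtain i0 j0 where max: "\<And>k l. u k l \<le> u i0 j0"
    using grid_fun_attains_max[OF N u] by blast
  define m where "m = u i0 j0"
  have le: "u k l \<le> m" for k l
    using max by (simp add: m_def)
  have nb: "u (i - 1) j = m \<and> u (i + 1) j = m \<and> u i (j - 1) = m \<and> u i (j + 1) = m"
    if "u i j = m" for i j
  proof -
    let ?A = "u (i - 1) j - 2 * u i j + u (i + 1) j" and ?B = "u i (j - 1) - 2 * u i j + u i (j + 1)"
    have AB: "?A \<le> 0" "?B \<le> 0"
      using le[of "i - 1" j] le[of "i + 1" j] le[of i "j - 1"] le[of i "j + 1"] that by simp_all
    have "?A / (mesh_size X1 N1)\<^sup>2 \<le> 0" "?B / (mesh_size X2 N2)\<^sup>2 \<le> 0"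
      using AB by (auto intro: divide_nonpos_nonneg)
    then have "?A / (mesh_size X1 N1)\<^sup>2 = 0" "?B / (mesh_size X2 N2)\<^sup>2 = 0"
      using harm[of i j] unfolding grid_lap_def by linarith+
    then have "?A = 0" "?B = 0"
      using h by simp_all
    then show ?thesis
      using le[of "i - 1" j] le[of "i + 1" j] le[of i "j - 1"] le[of i "j + 1"] that by linarith
  qed
  have row: "u i j0 = m" for i
    by (induction i rule: int_induct[where k = i0]) (use nb in \<open>auto simp: m_def\<close>)
  have "u i j = m" for i j
    by (induction j rule: int_induct[where k = j0]) (use nb row in auto)
  then show ?thesis
    by blast
qed

section \<open>Solvability of the discrete Poisson problem\<close>

text \<open>An injective square linear system indexed by an arbitrary finite set has a right inverse, obtained
  by enumerating the index set and inverting the matrix of the system.\<close>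

lemma finite_linear_system_right_inverse:
  fixes a :: "'a \<Rightarrow> 'a \<Rightarrow> real"
  assumes fin: "finite I"
    and inj: "\<And>x. (\<And>p. p \<in> I \<Longrightarrow> (\<Sum>q\<in>I. a p q * x q) = 0) \<Longrightarrow> \<forall>p\<in>I. x p = 0"
  obtains b where "\<And>g p. p \<in> I \<Longrightarrow> (\<Sum>q\<in>I. a p q * (\<Sum>r\<in>I. b q r * g r)) = g p"
proof -
  define n where "n = card I"
  obtain e where e: "bij_betw e {0..<n} I"
    using ex_bij_betw_nat_finite[OF fin] unfolding n_def by blast
  define k where "k = inv_into {0..<n} e"
  have ke: "k (e s) = s" if "s < n" for s
    using e that by (simp add: k_def bij_betw_def inv_into_f_f)
  have ek: "e (k p) = p" "k p < n" if "p \<in> I" for p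
    using e that bij_betwE[OF bij_betw_inv_into[OF e]]
    by (auto simp: k_def bij_betw_inv_into_right)
  have sum_e: "(\<Sum>q\<in>I. F q) = (\<Sum>s\<in>{0..<n}. F (e s))" for F :: "'a \<Rightarrow> real"
    by (rule sum.reindex_bij_betw[OF e, symmetric])
  define A where "A = mat n n (\<lambda>(s, t). a (e s) (e t))"
  have A: "A \<in> carrier_mat n n"
    by (simp add: A_def)
  have "det A \<noteq> 0"
  proof
    assume "det A = 0"
    then obtain v where v: "v \<in> carrier_vec n" "v \<noteq> 0\<^sub>v n" "A *\<^sub>v v = 0\<^sub>v n"
      using det_0_iff_vec_prod_zero_field[OF A] by blast
    define x where "x p = vec_index v (k p)" for p
    have "(\<Sum>q\<in>I. a p q * x q) = 0" if p: "p \<in> I" for p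
    proof -
      have "(\<Sum>q\<in>I. a p q * x q) = (\<Sum>s\<in>{0..<n}. a p (e s) * vec_index v s)"
        unfolding sum_e x_def by (intro sum.cong) (auto simp: ke)
      also have "\<dots> = vec_index (A *\<^sub>v v) (k p)"
        using v(1) ek[OF p] by (simp add: A_def scalar_prod_def)
      finally show ?thesis
        using v(3) ek[OF p] by simp
    qed
    then have "\<forall>p\<in>I. x p = 0"
      by (rule inj)
    then have "vec_index v s = 0" if "s < n" for s
      using that bij_betwE[OF e] ke[OF that] by (metis atLeastLessThan_iff zero_le x_def)
    then have "v = 0\<^sub>v n"
      using v(1) by (intro eq_vecI) auto
    with v(2) show False ..
  qed
  from det_non_zero_imp_unit[OF A this, of "()"]
  obtain B where B: "B \<in> carrier_mat n n" "A * B = 1\<^sub>m n"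
    by (auto simp: Units_def ring_mat_simps)
  define b where "b q r = B $$ (k q, k r)" for q r
  have ab: "(\<Sum>q\<in>I. a p q * b q r) = (if p = r then 1 else 0)" if "p \<in> I" "r \<in> I" for p r
  proof -
    have "(\<Sum>q\<in>I. a p q * b q r) = (\<Sum>s\<in>{0..<n}. a p (e s) * B $$ (s, k r))"
      unfolding sum_e b_def by (intro sum.cong) (auto simp: ke)
    also have "\<dots> = (A * B) $$ (k p, k r)"
      using B(1) ek that by (simp add: A_def scalar_prod_def)
    finally show ?thesis
      using B(2) ek that by (metis index_one_mat(1))
  qed
  have "(\<Sum>q\<in>I. a p q * (\<Sum>r\<in>I. b q r * g r)) = g p" if p: "p \<in> I" for g p
  proof -
    have "(\<Sum>q\<in>I. a p q * (\<Sum>r\<in>I. b q r * g r)) = (\<Sum>q\<in>I. \<Sum>r\<in>I. a p q * b q r * g r)"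
      by (simp add: sum_distrib_left mult.assoc)
    also have "\<dots> = (\<Sum>r\<in>I. (\<Sum>q\<in>I. a p q * b q r) * g r)"
      by (subst sum.swap) (simp add: sum_distrib_right)
    also have "\<dots> = (\<Sum>r\<in>I. (if p = r then g r else 0))"
      using p by (intro sum.cong) (auto simp: ab)
    also have "\<dots> = g p"
      using p fin by simp
    finally show ?thesis .
  qed
  then show thesis
    using that by blast
qed

lemma shifted_neg_lap_injective:
  assumes h: "mesh_size X1 N1 \<noteq> 0" "mesh_size X2 N2 \<noteq> 0"
    and N: "N1 > 0" "N2 > 0" and u: "u \<in> grid_fun N1 N2"
    and eq: "\<And>i j. - grid_lap X1 X2 N1 N2 u i j + (\<Sum>(k, l)\<in>grid_index N1 N2. u k l) = 0"
  shows "u i j = 0"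
proof -
  let ?s = "\<Sum>(k, l)\<in>grid_index N1 N2. u k l"
  \<comment> \<open>The Laplacian is the constant \<open>?s\<close>; it is nonpositive at a maximum and nonnegative at a minimum.\<close>
  obtain i1 j1 where "\<And>k l. u k l \<le> u i1 j1"
    using grid_fun_attains_max[OF N u] by blast
  then have "grid_lap X1 X2 N1 N2 u i1 j1 \<le> 0"
    by (rule grid_lap_nonpos_at_max)
  moreover obtain i2 j2 where "\<And>k l. - u k l \<le> - u i2 j2"
    using grid_fun_attains_max[OF N grid_fun_comp[OF u, of uminus]] by blast
  then have "grid_lap X1 X2 N1 N2 (\<lambda>i j. - u i j) i2 j2 \<le> 0"
    by (rule grid_lap_nonpos_at_max)
  then have "grid_lap X1 X2 N1 N2 u i2 j2 \<ge> 0"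
    by (simp add: grid_lap_uminus)
  ultimately have s0: "?s = 0"
    using eq[of i1 j1] eq[of i2 j2] by linarith
  then obtain c where c: "\<And>i j. u i j = c"
    using grid_harmonic_const[OF h N u] eq by auto
  have "?s = real (N1 * N2) * c"
    unfolding c by (simp add: card_grid_index case_prod_unfold)
  then show ?thesis
    using s0 N c by (simp add: card_grid_index)
qed

text \<open>The operator \<open>u \<mapsto> -\<Delta>\<^sub>h u + \<Sum> u\<close> on one period is an injective square system. On a right-hand
  side of zero mean its solution has zero mean, because the Laplacian sums to zero, so it
  solves the Poisson problem. The kernel \<open>b\<close> plays the role of a discrete Green function.\<close>

lemma discrete_Poisson_solvable:
  assumes h: "mesh_size X1 N1 \<noteq> 0" "mesh_size X2 N2 \<noteq> 0" and N: "N1 > 0" "N2 > 0"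
  obtains b :: "int \<times> int \<Rightarrow> int \<times> int \<Rightarrow> real" where
    "\<And>g u. g \<in> grid_fun N1 N2 \<Longrightarrow> (\<Sum>(k, l)\<in>grid_index N1 N2. g k l) = 0 \<Longrightarrow>
       u = (\<lambda>i j. \<Sum>r\<in>grid_index N1 N2. b (wrap N1 i, wrap N2 j) r * g (fst r) (snd r)) \<Longrightarrow>
       u \<in> grid_fun N1 N2 \<and> (\<Sum>(k, l)\<in>grid_index N1 N2. u k l) = 0 \<and>
       (\<forall>i j. - grid_lap X1 X2 N1 N2 u i j = g i j)"
proof -
  let ?I = "grid_index N1 N2"
  define \<delta> :: "int \<Rightarrow> int \<Rightarrow> int \<times> int \<Rightarrow> real" where
    "\<delta> i j q = (if q = (wrap N1 i, wrap N2 j) then 1 else 0)" for i j q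
  \<comment> \<open>Column \<open>q\<close> of the matrix: the operator applied to the periodic indicator function of \<open>q\<close>.\<close>
  define a where "a p q = 1 - grid_lap X1 X2 N1 N2 (\<lambda>i j. \<delta> i j q) (fst p) (snd p)" for p q
  \<comment> \<open>Periodic extension of a function given on one period.\<close>
  define E where "E x = (\<lambda>i j. x (wrap N1 i, wrap N2 j))" for x :: "int \<times> int \<Rightarrow> real"
  have E: "E x \<in> grid_fun N1 N2" for x
    unfolding E_def by (rule grid_fun_ext)
  have E_mem: "E x k l = x (k, l)" if "(k, l) \<in> ?I" for x k l
    using that by (simp add: E_def grid_index_def wrap_id)
  have sum_E: "(\<Sum>(k, l)\<in>?I. E x k l) = (\<Sum>q\<in>?I. x q)" for x
    by (intro sum.cong) (auto simp: E_mem)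
  have \<delta>: "(\<Sum>q\<in>?I. \<delta> i j q * x q) = E x i j" for x i j
  proof -
    have "(\<Sum>q\<in>?I. \<delta> i j q * x q) = (\<Sum>q\<in>?I. if q = (wrap N1 i, wrap N2 j) then x q else 0)"
      by (intro sum.cong) (auto simp: \<delta>_def)
    then show ?thesis
      using wrap_mem_grid_index[OF N] finite_grid_index by (simp add: E_def)
  qed
  have a: "(\<Sum>q\<in>?I. a (i, j) q * x q) =
      - grid_lap X1 X2 N1 N2 (E x) i j + (\<Sum>(k, l)\<in>?I. E x k l)" for i j x
  proof -
    have "(\<Sum>q\<in>?I. grid_lap X1 X2 N1 N2 (\<lambda>i j. \<delta> i j q) i j * x q) = grid_lap X1 X2 N1 N2 (E x) i j"
      unfolding grid_lap_def \<delta>[symmetric]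
      by (simp add: sum.distrib sum_subtractf sum_divide_distrib sum_distrib_left algebra_simps
            add_divide_distrib diff_divide_distrib)
    then show ?thesis
      unfolding sum_E by (simp add: a_def algebra_simps sum_subtractf)
  qed
  have lap_wrap: "grid_lap X1 X2 N1 N2 u (wrap N1 i) (wrap N2 j) = grid_lap X1 X2 N1 N2 u i j"
    if "u \<in> grid_fun N1 N2" for u i j
    by (rule grid_fun_wrap[OF grid_fun_lap[OF that]])
  obtain b where b: "\<And>g p. p \<in> ?I \<Longrightarrow> (\<Sum>q\<in>?I. a p q * (\<Sum>r\<in>?I. b q r * g r)) = g p"
  proof (rule finite_linear_system_right_inverse[OF finite_grid_index])
    fix x assume 0: "\<And>p. p \<in> ?I \<Longrightarrow> (\<Sum>q\<in>?I. a p q * x q) = 0"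
    have "- grid_lap X1 X2 N1 N2 (E x) i j + (\<Sum>(k, l)\<in>?I. E x k l) = 0" for i j
      using 0[OF wrap_mem_grid_index[OF N, of i j]] lap_wrap[OF E] by (simp add: a)
    then have "E x i j = 0" for i j
      by (rule shifted_neg_lap_injective[OF h N E])
    then show "\<forall>p\<in>?I. x p = 0"
      using E_mem by (metis surj_pair)
  qed blast
  show thesis
  proof (rule that[of b])
    fix g u
    assume g: "g \<in> grid_fun N1 N2" and g0: "(\<Sum>(k, l)\<in>?I. g k l) = 0"
      and u_def: "u = (\<lambda>i j. \<Sum>r\<in>?I. b (wrap N1 i, wrap N2 j) r * g (fst r) (snd r))"
    have uE: "u = E (\<lambda>q. \<Sum>r\<in>?I. b q r * g (fst r) (snd r))"
      by (simp add: E_def u_def)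
    have u: "u \<in> grid_fun N1 N2"
      unfolding uE by (rule E)
    have eq: "- grid_lap X1 X2 N1 N2 u i j + (\<Sum>(k, l)\<in>?I. u k l) = g i j" for i j
      using b[OF wrap_mem_grid_index[OF N, of i j], of "\<lambda>r. g (fst r) (snd r)"]
        lap_wrap[OF u] grid_fun_wrap[OF g]
      unfolding a uE[symmetric] by simp
    have "(\<Sum>(i, j)\<in>?I. - grid_lap X1 X2 N1 N2 u i j + (\<Sum>(k, l)\<in>?I. u k l)) = 0"
      using g0 eq by simp
    then have "real (N1 * N2) * (\<Sum>(k, l)\<in>?I. u k l) = 0"
      using sum_grid_lap[OF u, of X1 X2]
      by (simp add: case_prod_unfold sum_subtractf card_grid_index)
    then have s0: "(\<Sum>(k, l)\<in>?I. u k l) = 0"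
      using N by simp
    show "u \<in> grid_fun N1 N2 \<and> (\<Sum>(k, l)\<in>?I. u k l) = 0 \<and> (\<forall>i j. - grid_lap X1 X2 N1 N2 u i j = g i j)"
      using u s0 eq by simp
  qed
qed

lemma box_area_eq:
  assumes "X1 > 0" "X2 > 0"
  shows "box_area X1 X2 = 4 * X1 * X2"
proof -
  have "{-X1..X1} \<times> {-X2..X2} = cbox (-X1, -X2) (X1, X2)"
    by (simp add: cbox_Pair_eq)
  then have "box_area X1 X2 = measure lborel (cbox (-X1) X1) * measure lborel (cbox (-X2) X2)"
    unfolding box_area_def by (simp only: content_Pair)
  then show ?thesis
    using assms by simp
qed

lemma box_area_mesh:
  assumes "X1 > 0" "X2 > 0" "N1 > 0" "N2 > 0"
  shows "box_area X1 X2 = mesh_size X1 N1 * mesh_size X2 N2 * real (N1 * N2)"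
  using assms by (simp add: box_area_eq mesh_size_def)

lemma grid_mean_eq:
  assumes "X1 > 0" "X2 > 0" "N1 > 0" "N2 > 0"
  shows "1 / box_area X1 X2 * grid_inner X1 X2 N1 N2 g (\<lambda>_ _. 1) =
    (\<Sum>(k, l)\<in>grid_index N1 N2. g k l) / real (N1 * N2)"
  using assms unfolding grid_inner_def box_area_mesh[OF assms] by (simp add: mesh_size_def)

lemma abs_grid_sum_le:
  assumes "\<And>i j. \<bar>g i j\<bar> \<le> c"
  shows "\<bar>\<Sum>(k, l)\<in>grid_index N1 N2. g k l\<bar> \<le> real (N1 * N2) * c"
proof -
  have "\<bar>\<Sum>(k, l)\<in>grid_index N1 N2. g k l\<bar> \<le> (\<Sum>p\<in>grid_index N1 N2. c)"
    by (rule order_trans[OF sum_abs sum_mono]) (use assms in auto)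
  then show ?thesis
    by (simp add: card_grid_index)
qed

lemma abs_grid_inner_one_le:
  assumes "X1 > 0" "X2 > 0" "N1 > 0" "N2 > 0" and g: "\<And>i j. \<bar>g i j\<bar> \<le> c"
  shows "\<bar>grid_inner X1 X2 N1 N2 g (\<lambda>_ _. 1)\<bar> \<le> c * box_area X1 X2"
proof -
  have pos: "mesh_size X1 N1 * mesh_size X2 N2 > 0"
    using assms by (simp add: mesh_size_def)
  then have "\<bar>grid_inner X1 X2 N1 N2 g (\<lambda>_ _. 1)\<bar> =
      mesh_size X1 N1 * mesh_size X2 N2 * \<bar>\<Sum>(k, l)\<in>grid_index N1 N2. g k l\<bar>"
    unfolding grid_inner_def abs_mult[of "_ * _" "sum _ _"] by simp
  also have "\<dots> \<le> mesh_size X1 N1 * mesh_size X2 N2 * (real (N1 * N2) * c)"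
    using pos abs_grid_sum_le[OF g] by (intro mult_left_mono) auto
  finally show ?thesis
    unfolding box_area_mesh[OF assms(1-4)] by (simp add: mult_ac)
qed

lemma neg_lap_inv_bounded:
  assumes X: "X1 > 0" "X2 > 0" and N: "N1 > 0" "N2 > 0"
  obtains C where "\<And>g. g \<in> grid_fun N1 N2 \<Longrightarrow> neg_lap_inv X1 X2 N1 N2 g \<in> grid_fun N1 N2"
    and "\<And>g i j. g \<in> grid_fun N1 N2 \<Longrightarrow>
      \<bar>neg_lap_inv X1 X2 N1 N2 g i j\<bar> \<le> C * grid_Linf N1 N2 g"
proof -
  let ?I = "grid_index N1 N2"
  have h: "mesh_size X1 N1 \<noteq> 0" "mesh_size X2 N2 \<noteq> 0"
    using X N by (auto simp: mesh_size_def)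
  have inner0: "grid_inner X1 X2 N1 N2 u (\<lambda>_ _. 1) = 0 \<longleftrightarrow> (\<Sum>(k, l)\<in>?I. u k l) = 0" for u
    using h by (simp add: grid_inner_def)
  obtain b :: "int \<times> int \<Rightarrow> int \<times> int \<Rightarrow> real" where b:
    "\<And>g u. g \<in> grid_fun N1 N2 \<Longrightarrow> (\<Sum>(k, l)\<in>?I. g k l) = 0 \<Longrightarrow>
       u = (\<lambda>i j. \<Sum>r\<in>?I. b (wrap N1 i, wrap N2 j) r * g (fst r) (snd r)) \<Longrightarrow>
       u \<in> grid_fun N1 N2 \<and> (\<Sum>(k, l)\<in>?I. u k l) = 0 \<and>
       (\<forall>i j. - grid_lap X1 X2 N1 N2 u i j = g i j)"
    using discrete_Poisson_solvable[OF h N] by blast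
  \<comment> \<open>The factor 2 accounts for subtracting the mean, which is itself bounded by the maximum norm.\<close>
  define C where "C = (\<Sum>p\<in>?I. \<Sum>r\<in>?I. \<bar>b p r\<bar>) * 2"
  have "neg_lap_inv X1 X2 N1 N2 g \<in> grid_fun N1 N2 \<and>
      (\<forall>i j. \<bar>neg_lap_inv X1 X2 N1 N2 g i j\<bar> \<le> C * grid_Linf N1 N2 g)"
    if g: "g \<in> grid_fun N1 N2" for g
  proof -
    define m where "m = 1 / box_area X1 X2 * grid_inner X1 X2 N1 N2 g (\<lambda>_ _. 1)"
    have m: "m = (\<Sum>(k, l)\<in>?I. g k l) / real (N1 * N2)"
      unfolding m_def by (rule grid_mean_eq[OF X N])
    define L where "L = grid_Linf N1 N2 g"
    have gL: "\<bar>g i j\<bar> \<le> L" for i j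
      unfolding L_def by (rule grid_Linf_ge[OF N g])
    have mL: "\<bar>m\<bar> \<le> L"
      using abs_grid_sum_le[of g L, OF gL, of N1 N2] N
      by (simp add: m pos_divide_le_eq mult.commute)
    define u where "u = (\<lambda>i j. \<Sum>r\<in>?I. b (wrap N1 i, wrap N2 j) r * (g (fst r) (snd r) - m))"
    have "(\<Sum>(k, l)\<in>?I. g k l - m) = 0"
      using N by (simp add: case_prod_unfold sum_subtractf card_grid_index m)
    then have u: "u \<in> grid_fun N1 N2" "(\<Sum>(k, l)\<in>?I. u k l) = 0"
      "- grid_lap X1 X2 N1 N2 u i j = g i j - m" for i j
      using b[OF grid_fun_comp[OF g, of "\<lambda>y. y - m"] _ u_def] by auto
    have "neg_lap_inv X1 X2 N1 N2 g = u"
      unfolding neg_lap_inv_def m_def[symmetric] inner0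
    proof (rule the_equality)
      show "u \<in> grid_fun N1 N2 \<and> (\<Sum>(k, l)\<in>?I. u k l) = 0 \<and>
          (\<forall>i j. - grid_lap X1 X2 N1 N2 u i j = g i j - m)"
        using u by blast
    next
      fix v
      assume v: "v \<in> grid_fun N1 N2 \<and> (\<Sum>(k, l)\<in>?I. v k l) = 0 \<and>
          (\<forall>i j. - grid_lap X1 X2 N1 N2 v i j = g i j - m)"
      have "- grid_lap X1 X2 N1 N2 (\<lambda>i j. v i j - u i j) i j + (\<Sum>(k, l)\<in>?I. v k l - u k l) = 0" for i j
        using u(2) u(3)[of i j] v
        by (simp add: grid_lap_diff case_prod_unfold sum_subtractf minus_equation_iff)
      moreover have "(\<lambda>i j. v i j - u i j) \<in> grid_fun N1 N2"
        using v u(1) by (intro grid_fun_comp2[of v N1 N2 u "(-)"]) simp_all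
      ultimately have "v i j - u i j = 0" for i j
        using shifted_neg_lap_injective[OF h N, of "\<lambda>i j. v i j - u i j" i j] by simp
      then show "v = u"
        by (simp add: fun_eq_iff)
    qed
    moreover have "\<bar>u i j\<bar> \<le> C * L" for i j
    proof -
      let ?p = "(wrap N1 i, wrap N2 j)"
      have L0: "0 \<le> L"
        using gL[of 0 0] by simp
      have "\<bar>u i j\<bar> \<le> (\<Sum>r\<in>?I. \<bar>b ?p r\<bar> * (2 * L))"
        unfolding u_def
      proof (rule order_trans[OF sum_abs sum_mono])
        fix r
        have "\<bar>g (fst r) (snd r) - m\<bar> \<le> 2 * L"
          using gL[of "fst r" "snd r"] mL by linarith
        then show "\<bar>b ?p r * (g (fst r) (snd r) - m)\<bar> \<le> \<bar>b ?p r\<bar> * (2 * L)"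
          by (simp add: abs_mult mult_left_mono)
      qed
      also have "\<dots> = (\<Sum>r\<in>?I. \<bar>b ?p r\<bar>) * (2 * L)"
        by (simp add: sum_distrib_right)
      also have "\<dots> \<le> (\<Sum>p\<in>?I. \<Sum>r\<in>?I. \<bar>b p r\<bar>) * (2 * L)"
        using L0 wrap_mem_grid_index[OF N] finite_grid_index
        by (intro mult_right_mono member_le_sum) (auto intro: sum_nonneg)
      finally show ?thesis
        by (simp add: C_def mult.assoc)
    qed
    ultimately show ?thesis
      using u(1) by (simp add: L_def)
  qed
  then show thesis
    using that[of C] by blast
qed

text \<open>The infimum defining the operator norm is itself an admissible constant. The set of admissible
  constants must be nonempty for this, which is the boundedness just shown.\<close>

lemma neg_lap_inv_norm_bound:
  assumes X: "X1 > 0" "X2 > 0" and N: "N1 > 0" "N2 > 0"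
  shows "neg_lap_inv_norm X1 X2 N1 N2 \<ge> 0"
    and "g \<in> grid_fun N1 N2 \<Longrightarrow>
      \<bar>neg_lap_inv X1 X2 N1 N2 g i j\<bar> \<le> neg_lap_inv_norm X1 X2 N1 N2 * grid_Linf N1 N2 g"
proof -
  let ?inv = "neg_lap_inv X1 X2 N1 N2" and ?L = "grid_Linf N1 N2"
  let ?S = "{C. \<forall>g\<in>grid_fun N1 N2. ?L (?inv g) \<le> C * ?L g}"
  obtain C where C: "\<And>g. g \<in> grid_fun N1 N2 \<Longrightarrow> ?inv g \<in> grid_fun N1 N2"
    "\<And>g i j. g \<in> grid_fun N1 N2 \<Longrightarrow> \<bar>?inv g i j\<bar> \<le> C * ?L g"
    using neg_lap_inv_bounded[OF X N] by blast
  then have "C \<in> ?S"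
    using grid_Linf_le[OF N] by blast
  then have ne: "?S \<noteq> {}"
    by blast
  have L0: "?L u \<ge> 0" if "u \<in> grid_fun N1 N2" for u
    using grid_Linf_ge[OF N that, of 0 0] by simp
  have quot: "?L (?inv g) / ?L g \<le> neg_lap_inv_norm X1 X2 N1 N2"
    if g: "g \<in> grid_fun N1 N2" and pos: "?L g > 0" for g
    unfolding neg_lap_inv_norm_def
    using g pos by (intro cInf_greatest[OF ne]) (auto simp: pos_divide_le_eq)
  have one: "(\<lambda>_ _. 1) \<in> grid_fun N1 N2"
    by (simp add: grid_fun_def)
  have "?L (\<lambda>_ _. 1) > 0"
    using grid_Linf_ge[OF N one] by simp
  then have "0 \<le> ?L (?inv (\<lambda>_ _. 1)) / ?L (\<lambda>_ _. 1)"
    using L0[OF C(1)[OF one]] by simp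
  then show "neg_lap_inv_norm X1 X2 N1 N2 \<ge> 0"
    using quot[OF one] \<open>?L (\<lambda>_ _. 1) > 0\<close> by linarith
  assume g: "g \<in> grid_fun N1 N2"
  \<comment> \<open>If \<open>g\<close> vanishes, no quotient is available, but any admissible constant forces a zero solution.\<close>
  show "\<bar>?inv g i j\<bar> \<le> neg_lap_inv_norm X1 X2 N1 N2 * ?L g"
  proof (cases "?L g = 0")
    case True
    then show ?thesis
      using C(2)[OF g, of i j] by simp
  next
    case False
    then have "?L g > 0"
      using L0[OF g] by linarith
    then show ?thesis
      using quot[OF g] grid_Linf_ge[OF N C(1)[OF g], of i j] by (simp add: pos_divide_le_eq)
  qed
qed

section \<open>The nonlinear terms\<close>

text \<open>For a continuous function the essential supremum over the unit interval is a genuine pointwise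
  bound, also at the end points.\<close>

lemma abs_le_Linf_unit:
  fixes g :: "real \<Rightarrow> real"
  assumes cont: "continuous_on UNIV g" and s: "s \<in> {0..1}"
  shows "\<bar>g s\<bar> \<le> Linf_unit g"
proof -
  let ?M = "lebesgue_on {0..1::real}"
  define E where "E = esssup ?M (\<lambda>s. ereal \<bar>g s\<bar>)"
  have [measurable]: "g \<in> borel_measurable borel"
    using cont by (rule borel_measurable_continuous_onI)
  have gm: "(\<lambda>s. ereal \<bar>g s\<bar>) \<in> borel_measurable ?M"
    by (intro measurable_restrict_space1 measurable_completion) measurable
  have "compact (g ` {0..1})"
    using cont by (intro compact_continuous_image continuous_on_subset[OF cont]) auto
  then obtain B where B: "\<And>s. s \<in> {0..1} \<Longrightarrow> \<bar>g s\<bar> \<le> B"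
    by (metis bounded_iff compact_imp_bounded imageI real_norm_def)
  have "AE x in ?M. ereal \<bar>g x\<bar> \<le> ereal B"
    using B by (intro AE_I2) (auto simp: space_restrict_space)
  then have upper: "E \<le> ereal B"
    unfolding E_def by (rule esssup_I[OF gm])
  define C where "C = {x. ereal \<bar>g x\<bar> \<le> E}"
  have "closed C"
    unfolding C_def using cont by (intro closed_Collect_le continuous_intros)
  have "AE x in ?M. ereal \<bar>g x\<bar> \<le> E"
    unfolding E_def by (rule esssup_AE)
  then have "AE x in lebesgue. x \<in> {0..1} \<longrightarrow> ereal \<bar>g x\<bar> \<le> E"
    by (simp add: AE_restrict_space_iff)
  then have ae: "AE x \<in> {0<..<1} in lebesgue. x \<in> C"
    by (auto simp: C_def elim: eventually_mono)
  have "{0<..<1} \<subseteq> C"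
    using mem_closed_if_AE_lebesgue_open[OF open_greaterThanLessThan \<open>closed C\<close> ae] by blast
  then have "closure {0<..<1::real} \<subseteq> C"
    using \<open>closed C\<close> by (rule closure_minimal)
  then have le: "ereal \<bar>g s\<bar> \<le> E"
    using s by (auto simp: C_def closure_greaterThanLessThan)
  then obtain e where "E = ereal e"
    using upper by (cases E) auto
  then show ?thesis
    using le by (simp add: Linf_unit_def E_def[symmetric])
qed

lemma deriv_Wpot: "deriv Wpot = (\<lambda>s. 36 * (s\<^sup>2 - s) * (2 * s - 1))"
  unfolding Wpot_def
  by (rule ext, rule DERIV_imp_deriv, (rule derivative_eq_intros refl)+)
    (simp add: algebra_simps power2_eq_square)

lemma deriv_fint: "deriv fint = (\<lambda>s. 6 * s - 6 * s\<^sup>2)"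
  unfolding fint_def
  by (rule ext, rule DERIV_imp_deriv, (rule derivative_eq_intros refl)+)
    (simp add: algebra_simps power2_eq_square)

lemma DERIV_deriv_Wpot: "(deriv Wpot has_real_derivative 216 * s\<^sup>2 - 216 * s + 36) (at s)"
  unfolding deriv_Wpot
  by (auto intro!: derivative_eq_intros simp: algebra_simps power2_eq_square)

lemma deriv2_Wpot: "deriv (deriv Wpot) = (\<lambda>s. 216 * s\<^sup>2 - 216 * s + 36)"
  using DERIV_imp_deriv[OF DERIV_deriv_Wpot] by (rule ext)

lemma DERIV_deriv_fint: "(deriv fint has_real_derivative 6 - 12 * s) (at s)"
  unfolding deriv_fint by (auto intro!: derivative_eq_intros)

lemma deriv2_fint: "deriv (deriv fint) = (\<lambda>s. 6 - 12 * s)"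
  using DERIV_imp_deriv[OF DERIV_deriv_fint] by (rule ext)

lemma abs_deriv2_Wpot_le: "s \<in> {0..1} \<Longrightarrow> \<bar>deriv (deriv Wpot) s\<bar> \<le> Linf_unit (deriv (deriv Wpot))"
  by (rule abs_le_Linf_unit) (auto simp: deriv2_Wpot intro!: continuous_intros)

lemma abs_deriv2_fint_le: "s \<in> {0..1} \<Longrightarrow> \<bar>deriv (deriv fint) s\<bar> \<le> Linf_unit (deriv (deriv fint))"
  by (rule abs_le_Linf_unit) (auto simp: deriv2_fint intro!: continuous_intros)

lemma fint_unit:
  assumes "s \<in> {0..1}"
  shows "fint s \<in> {0..1}"
proof -
  have "fint s = s\<^sup>2 * (3 - 2 * s)" "1 - fint s = (1 - s)\<^sup>2 * (1 + 2 * s)"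
    by (simp_all add: fint_def algebra_simps power2_eq_square power3_eq_cube)
  moreover have "s\<^sup>2 * (3 - 2 * s) \<ge> 0" "(1 - s)\<^sup>2 * (1 + 2 * s) \<ge> 0"
    using assms by simp_all
  ultimately show ?thesis
    by simp
qed

text \<open>The explicit part of the scheme at a single grid point, as a function of the value \<open>s\<close> there, with
  the nonlocal coefficient \<open>A\<close> held fixed: under the stabilization condition it is nondecreasing on the unit
  interval, and \<open>W'\<close> and \<open>f'\<close> vanish at both
  end points.\<close>

lemma stabilized_reaction_bounds:
  assumes "\<epsilon> > 0" and s: "s \<in> {0..1}"
    and S: "S \<ge> Linf_unit (deriv (deriv Wpot)) / \<epsilon> + \<bar>A\<bar> * Linf_unit (deriv (deriv fint))"
  shows "S * s - 1 / \<epsilon> * deriv Wpot s - A * deriv fint s \<in> {0..S}"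
proof -
  define F where "F s = S * s - 1 / \<epsilon> * deriv Wpot s - A * deriv fint s" for s
  define F' where "F' s = S - 1 / \<epsilon> * deriv (deriv Wpot) s - A * deriv (deriv fint) s" for s
  have DF: "(F has_real_derivative F' x) (at x)" for x
    unfolding F_def F'_def deriv2_Wpot deriv2_fint
    by (rule derivative_eq_intros DERIV_deriv_Wpot DERIV_deriv_fint refl)+ (simp add: algebra_simps)
  have F'_nonneg: "F' x \<ge> 0" if x: "x \<in> {0..1}" for x
  proof -
    have "1 / \<epsilon> * deriv (deriv Wpot) x \<le> Linf_unit (deriv (deriv Wpot)) / \<epsilon>"
      using abs_deriv2_Wpot_le[OF x] \<open>\<epsilon> > 0\<close> by (simp add: divide_right_mono)
    moreover have "A * deriv (deriv fint) x \<le> \<bar>A\<bar> * \<bar>deriv (deriv fint) x\<bar>"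
      by (metis abs_ge_self abs_mult)
    moreover have "\<bar>A\<bar> * \<bar>deriv (deriv fint) x\<bar> \<le> \<bar>A\<bar> * Linf_unit (deriv (deriv fint))"
      by (intro mult_left_mono abs_deriv2_fint_le x) simp
    ultimately show ?thesis
      using S unfolding F'_def by linarith
  qed
  have mono: "F x \<le> F y" if "0 \<le> x" "x \<le> y" "y \<le> 1" for x y
  proof (rule DERIV_nonneg_imp_nondecreasing[OF that(2)])
    fix z assume "x \<le> z" "z \<le> y"
    then show "\<exists>D. (F has_real_derivative D) (at z) \<and> D \<ge> 0"
      using DF F'_nonneg that by (intro exI[of _ "F' z"]) auto
  qed
  have "F 0 = 0" "F 1 = S"
    by (simp_all add: F_def deriv_Wpot deriv_fint)
  then show ?thesis
    using mono[of 0 s] mono[of s 1] s by (simp add: F_def)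
qed

section \<open>The maximum principle\<close>

lemma elliptic_grid_max_principle:
  assumes N: "N1 > 0" "N2 > 0" and "S > 0" "\<epsilon> > 0" and u: "u \<in> grid_fun N1 N2"
    and le: "\<And>i j. S * u i j - \<epsilon> * grid_lap X1 X2 N1 N2 u i j \<le> S * c"
  shows "u i j \<le> c"
proof -
  obtain i0 j0 where max: "\<And>k l. u k l \<le> u i0 j0"
    using grid_fun_attains_max[OF N u] by blast
  have "\<epsilon> * grid_lap X1 X2 N1 N2 u i0 j0 \<le> 0"
    using grid_lap_nonpos_at_max[of u i0 j0, OF max] \<open>\<epsilon> > 0\<close> by (simp add: mult_nonneg_nonpos)
  then have "S * u i0 j0 \<le> S * c"
    using le[of i0 j0] by linarith
  then have "u i0 j0 \<le> c"
    using \<open>S > 0\<close> by simp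
  then show ?thesis
    using max[of i j] by linarith
qed

lemma elliptic_grid_min_principle:
  assumes N: "N1 > 0" "N2 > 0" and "S > 0" "\<epsilon> > 0" and u: "u \<in> grid_fun N1 N2"
    and ge: "\<And>i j. S * u i j - \<epsilon> * grid_lap X1 X2 N1 N2 u i j \<ge> S * c"
  shows "u i j \<ge> c"
proof -
  have "S * - u i j + \<epsilon> * grid_lap X1 X2 N1 N2 u i j \<le> S * - c" for i j
    using ge[of i j] by simp
  then have "- u i j \<le> - c"
    by (intro elliptic_grid_max_principle[OF N \<open>S > 0\<close> \<open>\<epsilon> > 0\<close> grid_fun_comp[OF u, of uminus],
          where ?X1.0 = X1 and ?X2.0 = X2])
      (simp add: grid_lap_uminus add.commute)
  then show ?thesis
    by simp
qed

theorem theorem4p1: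
  fixes X1 X2 \<epsilon> \<gamma> M \<kappa> \<omega> T \<tau> :: real
    and N1 N2 N :: nat
    and \<Phi> :: "nat \<Rightarrow> int \<Rightarrow> int \<Rightarrow> real"
  assumes "X1 > 0" and "X2 > 0"
    and "N1 > 0" and "even N1" and "N2 > 0" and "even N2"
    and "\<epsilon> > 0" and "\<gamma> > 0" and "M > 0" and "\<kappa> > 0"
    and "0 < \<omega>" and "\<omega> < 1"
    and "T > 0" and "N > 0" and "\<tau> = T / real N"
    and grid: "\<forall>n\<le>N. \<Phi> n \<in> grid_fun N1 N2"
    and scheme: "\<forall>n<N. \<forall>i j.
      (1 / \<tau> + \<kappa> / \<epsilon>) * (\<Phi> (n + 1) i j - \<Phi> n i j) =
        \<epsilon> * grid_lap X1 X2 N1 N2 (\<Phi> (n + 1)) i j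
        - 1 / \<epsilon> * deriv Wpot (\<Phi> n i j)
        - \<gamma> * neg_lap_inv X1 X2 N1 N2 (\<lambda>k l. fint (\<Phi> n k l) - \<omega>) i j * deriv fint (\<Phi> n i j)
        - M * grid_inner X1 X2 N1 N2 (\<lambda>k l. fint (\<Phi> n k l) - \<omega>) (\<lambda>_ _. 1)
            * deriv fint (\<Phi> n i j)"
    and stab: "1 / \<tau> + \<kappa> / \<epsilon> \<ge>
      Linf_unit (deriv (deriv Wpot)) / \<epsilon> +
      max \<omega> (1 - \<omega>) * Linf_unit (deriv (deriv fint)) *
        (\<gamma> * neg_lap_inv_norm X1 X2 N1 N2 + M * box_area X1 X2)"
    and init: "\<forall>i j. 0 \<le> \<Phi> 0 i j \<and> \<Phi> 0 i j \<le> 1"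
  shows "\<forall>n\<in>{1..N}. \<forall>i j. 0 \<le> \<Phi> n i j \<and> \<Phi> n i j \<le> 1"
proof -
  let ?S = "1 / \<tau> + \<kappa> / \<epsilon>" and ?w = "max \<omega> (1 - \<omega>)"
  note X = \<open>X1 > 0\<close> \<open>X2 > 0\<close> and N = \<open>N1 > 0\<close> \<open>N2 > 0\<close>
  have "\<tau> > 0"
    using \<open>T > 0\<close> \<open>N > 0\<close> \<open>\<tau> = T / real N\<close> by simp
  then have S: "?S > 0"
    using \<open>\<epsilon> > 0\<close> \<open>\<kappa> > 0\<close> by (simp add: add_pos_pos)
  have "\<forall>i j. 0 \<le> \<Phi> n i j \<and> \<Phi> n i j \<le> 1" if "n \<le> N" for n
    using that
  proof (induction n)
    case 0
    then show ?case
      using init by simp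
  next
    case (Suc n)
    then have n: "n < N" and unit: "\<And>i j. \<Phi> n i j \<in> {0..1}"
      by auto
    define g where "g = (\<lambda>i j. fint (\<Phi> n i j) - \<omega>)"
    define A where "A i j = \<gamma> * neg_lap_inv X1 X2 N1 N2 g i j
        + M * grid_inner X1 X2 N1 N2 g (\<lambda>_ _. 1)" for i j
    have g: "g \<in> grid_fun N1 N2"
      unfolding g_def using grid n by (intro grid_fun_comp[of _ _ _ "\<lambda>s. fint s - \<omega>"]) simp
    have gw: "\<bar>g i j\<bar> \<le> ?w" for i j
      using fint_unit[OF unit[of i j]] \<open>0 < \<omega>\<close> \<open>\<omega> < 1\<close> by (auto simp: g_def)
    have A_bound: "\<bar>A i j\<bar> \<le> ?w * (\<gamma> * neg_lap_inv_norm X1 X2 N1 N2 + M * box_area X1 X2)" for i j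
    proof -
      have "\<bar>neg_lap_inv X1 X2 N1 N2 g i j\<bar> \<le> neg_lap_inv_norm X1 X2 N1 N2 * grid_Linf N1 N2 g"
        by (rule neg_lap_inv_norm_bound(2)[OF X N g])
      also have "\<dots> \<le> neg_lap_inv_norm X1 X2 N1 N2 * ?w"
        by (intro mult_left_mono neg_lap_inv_norm_bound(1)[OF X N] grid_Linf_le[OF N] gw)
      finally have "\<gamma> * \<bar>neg_lap_inv X1 X2 N1 N2 g i j\<bar> \<le> \<gamma> * (neg_lap_inv_norm X1 X2 N1 N2 * ?w)"
        using \<open>\<gamma> > 0\<close> by (intro mult_left_mono) simp_all
      moreover have "M * \<bar>grid_inner X1 X2 N1 N2 g (\<lambda>_ _. 1)\<bar> \<le> M * (?w * box_area X1 X2)"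
        using abs_grid_inner_one_le[OF X N gw] \<open>M > 0\<close> by (intro mult_left_mono) simp_all
      moreover have "\<bar>A i j\<bar> \<le> \<gamma> * \<bar>neg_lap_inv X1 X2 N1 N2 g i j\<bar>
          + M * \<bar>grid_inner X1 X2 N1 N2 g (\<lambda>_ _. 1)\<bar>"
        unfolding A_def using \<open>\<gamma> > 0\<close> \<open>M > 0\<close>
        by (intro order_trans[OF abs_triangle_ineq]) (simp add: abs_mult)
      ultimately show ?thesis
        by (simp add: algebra_simps)
    qed
    have Lf: "Linf_unit (deriv (deriv fint)) \<ge> 0"
      using abs_deriv2_fint_le[of 0] by simp
    have stabA: "?S \<ge> Linf_unit (deriv (deriv Wpot)) / \<epsilon> + \<bar>A i j\<bar> * Linf_unit (deriv (deriv fint))" for i j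
      using stab mult_right_mono[OF A_bound[of i j] Lf] by (simp add: mult_ac)
    have eq: "?S * \<Phi> (Suc n) i j - \<epsilon> * grid_lap X1 X2 N1 N2 (\<Phi> (Suc n)) i j =
        ?S * \<Phi> n i j - 1 / \<epsilon> * deriv Wpot (\<Phi> n i j) - A i j * deriv fint (\<Phi> n i j)" for i j
    proof -
      have "?S * (\<Phi> (Suc n) i j - \<Phi> n i j) =
          \<epsilon> * grid_lap X1 X2 N1 N2 (\<Phi> (Suc n)) i j - 1 / \<epsilon> * deriv Wpot (\<Phi> n i j)
          - A i j * deriv fint (\<Phi> n i j)"
        using scheme n unfolding A_def g_def by (simp add: distrib_right diff_diff_eq)
      then show ?thesis
        unfolding right_diff_distrib by linarith
    qed
    have range: "?S * \<Phi> (Suc n) i j - \<epsilon> * grid_lap X1 X2 N1 N2 (\<Phi> (Suc n)) i j \<in> {0..?S}" for i j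
      unfolding eq by (rule stabilized_reaction_bounds[OF \<open>\<epsilon> > 0\<close> unit stabA])
    have "\<Phi> (Suc n) \<in> grid_fun N1 N2"
      using grid Suc.prems by simp
    from elliptic_grid_max_principle[OF N S \<open>\<epsilon> > 0\<close> this, where ?X1.0 = X1 and ?X2.0 = X2 and c = 1]
      elliptic_grid_min_principle[OF N S \<open>\<epsilon> > 0\<close> this, where ?X1.0 = X1 and ?X2.0 = X2 and c = 0] range
    show ?case
      by simp
  qed
  then show ?thesis
    by simp
qed

end
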